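(* Let $G$ be a nontrivial connected graph and let $\overline{G}$ denote its complement. Suppose that $\overline{G}$ falls in neither of the following two cases: (i) $\overline{G}$ is connected with $\mathrm{diam}(\overline{G})\in\{2,3\}$; (ii) $\overline{G}$ has exactly two connected components and one of them is trivial (a single vertex). Then $rc(G)\leq 4$. Furthermore, this bound is best possible: there exist connected graphs $G$ satisfying these hypotheses with $rc(G)=4$.
   Context: All graphs are finite, undirected and simple. For an edge-coloring $c:E(G)\to\{1,\dots,k\}$ (adjacent edges may receive the same color), a path is rainbow if no two of its edges have the same color; $G$ is rainbow connected under $c$ if every two vertices are joined by a rainbow path. The rainbow connection number $rc(G)$ of a nontrivial connected graph $G$ is the minimum $k$ for which such a coloring with $k$ colors exists. $\mathrm{diam}(H)$ denotes the diameter of a connected graph $H$, and $\overline{G}$ is the complement of $G$. *)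

theory Defs
  imports "Graph_Theory.Graph_Theory" "HOL-Library.FuncSet"
begin

text \<open>
  Finite simple undirected graphs are the \<^locale>\<open>pair_graph\<close>s of the library: finite, loop-free,
  symmetric digraphs whose arcs are pairs of vertices. An undirected edge \<open>uv\<close> is represented by
  the two arcs \<open>(u, v)\<close> and \<open>(v, u)\<close>; colourings are therefore given on the two-element sets
  \<open>{u, v}\<close>, so that both arcs necessarily receive the same colour.
\<close>

definition uedge :: "'a \<times> 'a \<Rightarrow> 'a set" where
  "uedge e = {fst e, snd e}"

definition uedges :: "'a pair_pre_digraph \<Rightarrow> 'a set set" where
  "uedges G = uedge ` parcs G"

definition complement :: "'a pair_pre_digraph \<Rightarrow> 'a pair_pre_digraph" where
  "complement G =
    \<lparr> pverts = pverts G,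
      parcs = {(u, v). u \<in> pverts G \<and> v \<in> pverts G \<and> u \<noteq> v \<and> (u, v) \<notin> parcs G} \<rparr>"

definition nontrivial_graph :: "'a pair_pre_digraph \<Rightarrow> bool" where
  "nontrivial_graph G \<longleftrightarrow> card (pverts G) \<ge> 2"

text \<open>
  With unit weights, \<open>\<mu>\<close> is the usual graph distance (infinite if there is no walk).
\<close>

definition diam :: "'a pair_pre_digraph \<Rightarrow> ereal" where
  "diam G = (SUP (u, v) \<in> pverts G \<times> pverts G. wf_digraph.\<mu> (with_proj G) (\<lambda>_. 1) u v)"

text \<open>
  In a symmetric digraph the strongly connected components are exactly the connected components
  of the underlying undirected graph.
\<close>

abbreviation components :: "'a pair_pre_digraph \<Rightarrow> ('a, 'a \<times> 'a) pre_digraph set" where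
  "components G \<equiv> pre_digraph.sccs (with_proj G)"

definition edge_coloring :: "'a pair_pre_digraph \<Rightarrow> nat \<Rightarrow> ('a set \<Rightarrow> nat) \<Rightarrow> bool" where
  "edge_coloring G k c \<longleftrightarrow> c \<in> uedges G \<rightarrow> {1..k}"

definition rainbow :: "('a set \<Rightarrow> nat) \<Rightarrow> ('a \<times> 'a) awalk \<Rightarrow> bool" where
  "rainbow c p \<longleftrightarrow> distinct (map (\<lambda>e. c (uedge e)) p)"

definition rainbow_connected :: "'a pair_pre_digraph \<Rightarrow> ('a set \<Rightarrow> nat) \<Rightarrow> bool" where
  "rainbow_connected G c \<longleftrightarrow>
    (\<forall>u \<in> pverts G. \<forall>v \<in> pverts G. \<exists>p. pre_digraph.apath (with_proj G) u p v \<and> rainbow c p)"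

text \<open>
  Meaningful for finite connected graphs only: there, giving distinct colours to all edges shows
  that the set of admissible \<open>k\<close> is nonempty.
\<close>

definition rc :: "'a pair_pre_digraph \<Rightarrow> nat" where
  "rc G = (LEAST k. \<exists>c. edge_coloring G k c \<and> rainbow_connected G c)"

end

theory Submission
  imports Defs
begin

text \<open>
  Call \<open>l : V \<rightarrow> {0,\<dots>,4}\<close> a layering if vertices whose layers differ by at least two are adjacent
  in \<open>G\<close> and the layers 0, 1, 3, 4 are inhabited. Colour the edges between layers by
  \<open>13, 02 \<mapsto> 1\<close>, \<open>03, 24 \<mapsto> 2\<close>, \<open>04 \<mapsto> 3\<close>, \<open>14 \<mapsto> 4\<close>, and all others arbitrarily. The closed walk
  \<open>0-3-1-4-0\<close> is rainbow and joins any two vertices of one of the layers 0, 1, 3, 4; the walk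
  \<open>2-0-4-2\<close> serves layer 2, and \<open>0-3-1\<close>, \<open>1-4-2\<close>, \<open>2-0-3\<close>, \<open>3-0-4\<close> serve consecutive layers.

  If the complement is connected of diameter at least 4, the distance layers from an end of a
  diametral pair (with everything at distance \<open>\<ge> 4\<close> merged) form a layering. If the complement is
  disconnected, then either \<open>G\<close> is complete, or a nontrivial component of the complement and the
  union of the other components are completely joined in \<open>G\<close>; splitting each of these two sides
  into a single vertex and the rest gives a layering with empty layer 2.

  For sharpness, in a 3-coloured \<open>K\<^sub>2\<^sub>,\<^sub>1\<^sub>0\<close> two vertices of the large side see the same pair of
  colours, and a rainbow path between them can only have length 2.
\<close>

lemma (in wf_digraph) strongly_connected_imp_connected:
  assumes "strongly_connected G"
  shows "connected G"
  using assms by (intro connectedI) (auto simp: strongly_connected_def intro: reachable_mk_symmetricI)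

section \<open>Rainbow paths\<close>

definition rainbow_joined ::
    "'a pair_pre_digraph \<Rightarrow> ('a set \<Rightarrow> nat) \<Rightarrow> 'a \<Rightarrow> 'a \<Rightarrow> bool" where
  "rainbow_joined G c u v \<longleftrightarrow> (\<exists>p. pre_digraph.apath (with_proj G) u p v \<and> rainbow c p)"

text \<open>Colours sit on unordered pairs, so reversal only reverses the list of colours. This
  makes \<open>rainbow_joined\<close> symmetric.\<close>

lemma rainbow_rev_path: "rainbow c (rev_path p) = rainbow c p"
proof -
  have "map (\<lambda>e. c (uedge e)) (rev_path p) = rev (map (\<lambda>e. c (uedge e)) p)"
    by (induction p) (auto simp: uedge_def insert_commute)
  then show ?thesis
    unfolding rainbow_def by simp
qed

context pair_graph
begin

lemma rainbow_joined_sym: "rainbow_joined G c u v \<Longrightarrow> rainbow_joined G c v u"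
  unfolding rainbow_joined_def by (metis apath_rev_path rainbow_rev_path)

lemma rainbow_joined_refl: "u \<in> pverts G \<Longrightarrow> rainbow_joined G c u u"
  unfolding rainbow_joined_def
  by (rule exI[of _ "[]"]) (auto simp: apath_simps rainbow_def)

lemma rainbow_joined_arc: "(u, v) \<in> parcs G \<Longrightarrow> rainbow_joined G c u v"
  unfolding rainbow_joined_def
  by (rule exI[of _ "[(u, v)]"])
    (auto simp: apath_simps rainbow_def dest: in_arcsD2 no_loops')

text \<open>Since there are no loops, \<open>u \<noteq> v\<close> already makes all three vertices
  distinct; longer paths need full distinctness.\<close>

lemma rainbow_joined_path2:
  assumes "(u, a) \<in> parcs G" "(a, v) \<in> parcs G" "u \<noteq> v" "distinct [c {u, a}, c {a, v}]"
  shows "rainbow_joined G c u v"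
  unfolding rainbow_joined_def using assms
  by (intro exI[of _ "[(u, a), (a, v)]"])
    (auto simp: apath_simps rainbow_def uedge_def dest: in_arcsD2 no_loops')

lemma rainbow_joined_path3:
  assumes "(u, a) \<in> parcs G" "(a, b) \<in> parcs G" "(b, v) \<in> parcs G"
    and "distinct [u, a, b, v]" "distinct [c {u, a}, c {a, b}, c {b, v}]"
  shows "rainbow_joined G c u v"
  unfolding rainbow_joined_def using assms
  by (intro exI[of _ "[(u, a), (a, b), (b, v)]"])
    (auto simp: apath_simps rainbow_def uedge_def dest: in_arcsD2)

lemma rainbow_joined_path4:
  assumes "(u, a) \<in> parcs G" "(a, b) \<in> parcs G" "(b, d) \<in> parcs G" "(d, v) \<in> parcs G"
    and "distinct [u, a, b, d, v]" "distinct [c {u, a}, c {a, b}, c {b, d}, c {d, v}]"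
  shows "rainbow_joined G c u v"
  unfolding rainbow_joined_def using assms
  by (intro exI[of _ "[(u, a), (a, b), (b, d), (d, v)]"])
    (auto simp: apath_simps rainbow_def uedge_def dest: in_arcsD2)

section \<open>Colouring a layered graph\<close>

text \<open>Only fixed representatives of layers 0, 1, 3, 4 serve as inner vertices of the paths, so
  layer 2 may be empty. Every arc used joins layers at least two apart and is supplied by
  \<open>far\<close>.\<close>

lemma layered_four_rainbow_coloring:
  fixes l :: "'a \<Rightarrow> nat"
  assumes le4: "\<And>v. v \<in> pverts G \<Longrightarrow> l v \<le> 4"
    and far: "\<And>u v. u \<in> pverts G \<Longrightarrow> v \<in> pverts G \<Longrightarrow> l u + 2 \<le> l v \<Longrightarrow> (u, v) \<in> parcs G"
    and inhabited: "{0, 1, 3, 4} \<subseteq> l ` pverts G"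
  shows "\<exists>c. edge_coloring G 4 c \<and> rainbow_connected G c"
proof -
  \<comment> \<open>Working on sets of layers makes the colour independent of direction. The default
    1 is the intended colour of \<open>{0, 2}\<close> and \<open>{1, 3}\<close>, and a dummy for
    edges within a layer or between consecutive layers.\<close>
  define f :: "nat set \<Rightarrow> nat" where
    "f S = (if S = {0, 3} \<or> S = {2, 4} then 2 else if S = {0, 4} then 3
            else if S = {1, 4} then 4 else 1)" for S
  define c where "c e = f (l ` e)" for e
  have c: "c {u, v} = f {l u, l v}" for u v
    by (simp add: c_def)
  have f: "f {0, 2} = 1" "f {2, 0} = 1" "f {1, 3} = 1" "f {3, 1} = 1"
    "f {0, 3} = 2" "f {3, 0} = 2" "f {2, 4} = 2" "f {4, 2} = 2"
    "f {0, 4} = 3" "f {4, 0} = 3" "f {1, 4} = 4" "f {4, 1} = 4"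
    by (simp_all add: f_def doubleton_eq_iff)
  obtain x0 x1 x3 x4 where x: "x0 \<in> pverts G" "x1 \<in> pverts G" "x3 \<in> pverts G" "x4 \<in> pverts G"
    and lx: "l x0 = 0" "l x1 = 1" "l x3 = 3" "l x4 = 4"
    using inhabited by (auto simp: image_iff)
  have far': "(u, v) \<in> parcs G"
    if "u \<in> pverts G" "v \<in> pverts G" "l u + 2 \<le> l v \<or> l v + 2 \<le> l u" for u v
    using far that arcs_symmetric by blast
  have joined: "rainbow_joined G c u v"
    if u: "u \<in> pverts G" and v: "v \<in> pverts G" and "u \<noteq> v" and "l u \<le> l v" for u v
  proof -
    consider "l u + 2 \<le> l v" | "l v = l u + 1" | "l v = l u"
      using \<open>l u \<le> l v\<close> by linarith
    then show ?thesis
    proof cases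
      case 1
      then show ?thesis using far u v rainbow_joined_arc by blast
    next
      case 2
      \<comment> \<open>Each pair of consecutive layers has a representative at least two layers
        from both: \<open>x3\<close>, \<open>x4\<close>, \<open>x0\<close>, \<open>x0\<close> in
        turn. The colour pairs are (2,1), (4,2), (1,2), (2,3).\<close>
      then consider "l u = 0" "l v = 1" | "l u = 1" "l v = 2" | "l u = 2" "l v = 3"
        | "l u = 3" "l v = 4"
        using le4[OF v] by linarith
      then show ?thesis
      proof cases
        case 1
        then show ?thesis
          using u v x lx \<open>u \<noteq> v\<close>
          by (intro rainbow_joined_path2[of u x3 v])
            (auto intro!: far' simp: c f simp del: One_nat_def)
      next
        case 2
        then show ?thesis
          using u v x lx \<open>u \<noteq> v\<close>
          by (intro rainbow_joined_path2[of u x4 v])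
            (auto intro!: far' simp: c f simp del: One_nat_def)
      next
        case 3
        then show ?thesis
          using u v x lx \<open>u \<noteq> v\<close>
          by (intro rainbow_joined_path2[of u x0 v])
            (auto intro!: far' simp: c f simp del: One_nat_def)
      next
        case 4
        then show ?thesis
          using u v x lx \<open>u \<noteq> v\<close>
          by (intro rainbow_joined_path2[of u x0 v])
            (auto intro!: far' simp: c f simp del: One_nat_def)
      qed
    next
      case 3
      \<comment> \<open>The closed walk is opened at the common layer, with \<open>u\<close> and
        \<open>v\<close> as its two ends. The inner vertices lie in other layers, so they differ
        from both.\<close>
      from le4[OF u] consider "l u = 0" | "l u = 1" | "l u = 2" | "l u = 3" | "l u = 4"
        by linarith
      then show ?thesis
      proof cases
        case 1
        with 3 show ?thesis
          using u v x lx \<open>u \<noteq> v\<close>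
          by (intro rainbow_joined_path4[of u x3 x1 x4 v])
            (auto intro!: far' simp: c f simp del: One_nat_def)
      next
        case 2
        with 3 show ?thesis
          using u v x lx \<open>u \<noteq> v\<close>
          by (intro rainbow_joined_path4[of u x3 x0 x4 v])
            (auto intro!: far' simp: c f simp del: One_nat_def)
      next
        case 3
        with \<open>l v = l u\<close> show ?thesis
          using u v x lx \<open>u \<noteq> v\<close>
          by (intro rainbow_joined_path3[of u x0 x4 v])
            (auto intro!: far' simp: c f simp del: One_nat_def)
      next
        case 4
        with 3 show ?thesis
          using u v x lx \<open>u \<noteq> v\<close>
          by (intro rainbow_joined_path4[of u x0 x4 x1 v])
            (auto intro!: far' simp: c f simp del: One_nat_def)
      next
        case 5
        with 3 show ?thesis
          using u v x lx \<open>u \<noteq> v\<close>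
          by (intro rainbow_joined_path4[of u x0 x3 x1 v])
            (auto intro!: far' simp: c f simp del: One_nat_def)
      qed
    qed
  qed
  have "rainbow_joined G c u v" if "u \<in> pverts G" "v \<in> pverts G" for u v
    using joined[of u v] joined[of v u] that rainbow_joined_refl rainbow_joined_sym
    by (metis nat_le_linear)
  then have "rainbow_connected G c"
    by (simp add: rainbow_connected_def rainbow_joined_def)
  moreover have "edge_coloring G 4 c"
    by (auto simp: edge_coloring_def c_def f_def)
  ultimately show ?thesis
    by blast
qed

section \<open>The complement\<close>

lemma pair_graph_complement: "pair_graph (complement G)"
proof -
  have "parcs (complement G) \<subseteq> pverts G \<times> pverts G"
    by (auto simp: complement_def)
  then have "finite (parcs (complement G))"
    using pair_finite_verts finite_cartesian_product finite_subset by metis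
  then show ?thesis
    using pair_finite_verts
    by unfold_locales
      (auto simp: complement_def symmetric_def intro!: symI dest: arcs_symmetric)
qed

lemma pverts_complement [simp]: "pverts (complement G) = pverts G"
  by (simp add: complement_def)

lemma arc_or_complement_arc:
  assumes "u \<in> pverts G" "v \<in> pverts G" "u \<noteq> v"
  shows "(u, v) \<in> parcs (complement G) \<longleftrightarrow> (u, v) \<notin> parcs G"
  using assms by (auto simp: complement_def)

section \<open>Distances, diameter and distance layers\<close>

lemma unit_distance_attained:
  assumes "u \<rightarrow>\<^sup>*\<^bsub>with_proj G\<^esub> v"
  shows "\<exists>p. awalk u p v \<and> \<mu> (\<lambda>_. 1) u v = ereal (real (length p))"
proof -
  have cost: "awalk_cost (\<lambda>_. 1) p = real (length p)" for p :: "('a \<times> 'a) list"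
    by (induction p) auto
  \<comment> \<open>Unit weights exclude negative cycles, so the infimum of the walk costs is
    attained by a path.\<close>
  have "\<exists>p. apath u p v \<and> \<mu> (\<lambda>_. 1) u v = awalk_cost (\<lambda>_. 1) p"
    using assms by (intro no_neg_cyc_reach_imp_path) (auto simp: cost)
  then show ?thesis
    by (auto simp: cost apath_def)
qed

lemma unit_distance_le_length:
  assumes "awalk u p v"
  shows "\<mu> (\<lambda>_. 1) u v \<le> ereal (real (length p))"
proof -
  have cost: "awalk_cost (\<lambda>_. 1) p = real (length p)" for p :: "('a \<times> 'a) list"
    by (induction p) auto
  show ?thesis
    using min_cost_le_walk_cost[OF assms, of "\<lambda>_. 1"] by (simp add: cost)
qed

text \<open>The supremum ranges over a finite nonempty set, hence is a maximum, and strong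
  connectivity makes it the length of a walk. Thus the diameter can be handled as a natural
  number.\<close>

lemma diam_attained:
  assumes "strongly_connected (with_proj G)"
  shows "\<exists>u p v. awalk u p v \<and> \<mu> (\<lambda>_. 1) u v = ereal (real (length p)) \<and>
    diam G = ereal (real (length p))"
proof -
  let ?D = "(\<lambda>(u, v). \<mu> (\<lambda>_. 1) u v) ` (pverts G \<times> pverts G)"
  have ne: "pverts G \<noteq> {}"
    and reach: "\<And>u v. u \<in> pverts G \<Longrightarrow> v \<in> pverts G \<Longrightarrow> u \<rightarrow>\<^sup>*\<^bsub>with_proj G\<^esub> v"
    using assms by (auto simp: strongly_connected_def)
  have "finite ?D" "?D \<noteq> {}"
    using pair_finite_verts ne by auto
  then have "Sup ?D \<in> ?D"
    by (metis Max_Sup Max_in)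
  then obtain u v where "u \<in> pverts G" "v \<in> pverts G" "diam G = \<mu> (\<lambda>_. 1) u v"
    by (auto simp: diam_def)
  with unit_distance_attained[OF reach] show ?thesis
    by metis
qed

text \<open>A discrete intermediate value theorem: along a walk the layer may drop freely but climbs
  by at most one per arc, so it cannot jump over \<open>i\<close>.\<close>

lemma intermediate_layer:
  fixes l :: "'a \<Rightarrow> nat"
  assumes "awalk u p v" and "\<And>a b. (a, b) \<in> parcs G \<Longrightarrow> l b \<le> l a + 1"
    and "l u \<le> i" "i \<le> l v"
  shows "i \<in> l ` pverts G"
  using assms(1,3)
proof (induction p arbitrary: u)
  case Nil
  then show ?case using assms(4) by (auto simp: awalk_Nil_iff)
next
  case (Cons e p)
  then have e: "e \<in> parcs G" "u = fst e" "awalk (snd e) p v" and u: "u \<in> pverts G"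
    by (auto simp: awalk_Cons_iff dest: arc_fst_in_verts)
  show ?case
  proof (cases "l u = i")
    case True
    then show ?thesis using u by blast
  next
    case False
    have "l (snd e) \<le> l u + 1"
      using assms(2)[of "fst e" "snd e"] e by simp
    then show ?thesis
      using Cons.IH[OF e(3)] Cons.prems(2) False by simp
  qed
qed

text \<open>Take the distance from \<open>x\<close>, cut off at \<open>n\<close>. By
  \<open>long\<close>, \<open>y\<close> reaches the top layer, and a walk from \<open>x\<close> to
  \<open>y\<close> meets all layers in between.\<close>

lemma distance_layers:
  assumes "strongly_connected (with_proj G)"
    and "x \<in> pverts G" "y \<in> pverts G" and long: "\<And>p. awalk x p y \<Longrightarrow> n \<le> length p"
  shows "\<exists>l :: 'a \<Rightarrow> nat. (\<forall>v. l v \<le> n) \<and> (\<forall>(a, b) \<in> parcs G. l b \<le> l a + 1) \<and>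
    {..n} \<subseteq> l ` pverts G"
proof -
  \<comment> \<open>Outside the vertex set this value is unspecified; the cut-off in
    \<open>l\<close> still gives \<open>l v \<le> n\<close> for every \<open>v\<close>.\<close>
  define d where "d v = (LEAST k. \<exists>p. awalk x p v \<and> length p = k)" for v
  define l where "l v = min n (d v)" for v
  have d_walk: "\<exists>p. awalk x p v \<and> length p = d v" if "v \<in> pverts G" for v
  proof -
    have "x \<rightarrow>\<^sup>*\<^bsub>with_proj G\<^esub> v"
      using assms(1,2) that by (auto simp: strongly_connected_def)
    then obtain p where "awalk x p v"
      by (auto simp: reachable_awalk)
    then have "\<exists>k p. awalk x p v \<and> length p = k"
      by blast
    then show ?thesis
      unfolding d_def by (rule LeastI_ex)
  qed
  have d_le: "d v \<le> length p" if "awalk x p v" for p v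
    unfolding d_def using that by (blast intro: Least_le)
  have step: "l b \<le> l a + 1" if ab: "(a, b) \<in> parcs G" for a b
  proof -
    obtain p where p: "awalk x p a" "length p = d a"
      using d_walk in_arcsD1[OF ab] by blast
    have "awalk a [(a, b)] b"
      using ab by (auto simp: awalk_simps dest: in_arcsD2)
    with p have "awalk x (p @ [(a, b)]) b"
      by auto
    from d_le[OF this] p show ?thesis
      by (simp add: l_def)
  qed
  obtain q where q: "awalk x q y" "length q = d y"
    using d_walk assms(3) by blast
  have "l y = n"
    using long[OF q(1)] q(2) by (simp add: l_def)
  moreover have "l x = 0"
    using d_le[of "[]" x] assms(2) by (simp add: l_def awalk_Nil_iff)
  ultimately have "{..n} \<subseteq> l ` pverts G"
    using intermediate_layer[OF q(1) step] by auto
  moreover have "\<forall>v. l v \<le> n"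
    by (simp add: l_def)
  ultimately show ?thesis
    using step by blast
qed

section \<open>Connected complement\<close>

lemma four_rainbow_coloring_connected_complement:
  assumes nontrivial: "nontrivial_graph G" and conn: "connected (with_proj G)"
    and conn_compl: "connected (with_proj (complement G))"
    and diam: "diam (complement G) \<notin> {2, 3}"
  shows "\<exists>c. edge_coloring G 4 c \<and> rainbow_connected G c"
proof -
  interpret H: pair_graph "complement G"
    by (rule pair_graph_complement)
  have scH: "strongly_connected (with_proj (complement G))"
    using conn_compl H.sym_arcs by (intro H.symmetric_connected_imp_strongly_connected)
  then obtain x p y where p: "H.awalk x p y" and mu: "H.\<mu> (\<lambda>_. 1) x y = ereal (real (length p))"
    and dm: "diam (complement G) = ereal (real (length p))"
    using H.diam_attained by blast
  have xy: "x \<in> pverts G" "y \<in> pverts G"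
    using H.awalk_hd_in_verts[OF p] H.awalk_last_in_verts[OF p] by auto
  have short: "\<exists>q. H.awalk u q v \<and> length q \<le> length p" if "u \<in> pverts G" "v \<in> pverts G" for u v
  proof -
    have "u \<rightarrow>\<^sup>*\<^bsub>with_proj (complement G)\<^esub> v"
      using scH that by (auto simp: strongly_connected_def)
    then obtain q where q: "H.awalk u q v" "H.\<mu> (\<lambda>_. 1) u v = ereal (real (length q))"
      using H.unit_distance_attained by blast
    have "H.\<mu> (\<lambda>_. 1) u v \<le> diam (complement G)"
      unfolding diam_def using that by (auto intro!: SUP_upper2[of "(u, v)"])
    with q dm show ?thesis
      by auto
  qed
  \<comment> \<open>Diameter at most 1 would make the complement complete and \<open>G\<close>
    arcless, although \<open>G\<close> is connected with at least two vertices. As 2 and 3 are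
    excluded, the diameter is at least 4.\<close>
  have "\<not> length p \<le> 1"
  proof
    assume le1: "length p \<le> 1"
    have no_arc: "(u, v) \<notin> parcs G" for u v
    proof
      assume uv: "(u, v) \<in> parcs G"
      then have V: "u \<in> pverts G" "v \<in> pverts G" "u \<noteq> v"
        by (auto dest: in_arcsD1 in_arcsD2 no_loops')
      obtain q where q: "H.awalk u q v" "length q \<le> 1"
        using short[OF V(1,2)] le1 by (meson le_trans)
      then have "(u, v) \<in> parcs (complement G)"
        using V(3) by (cases q) (auto simp: H.awalk_simps)
      with uv V show False
        by (simp add: arc_or_complement_arc)
    qed
    from nontrivial obtain u v where uv: "u \<in> pverts G" "v \<in> pverts G" "u \<noteq> v"
      unfolding nontrivial_graph_def using card_le_Suc0_iff_eq[OF pair_finite_verts] by force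
    have "strongly_connected (with_proj G)"
      using conn sym_arcs by (intro symmetric_connected_imp_strongly_connected)
    then have "u \<rightarrow>\<^sup>*\<^bsub>with_proj G\<^esub> v"
      using uv by (auto simp: strongly_connected_def)
    then obtain q where "awalk u q v"
      by (auto simp: reachable_awalk)
    then show False
      using uv(3) no_arc by (cases q) (auto simp: awalk_simps)
  qed
  moreover have "length p \<noteq> 2" "length p \<noteq> 3"
    using diam dm by auto
  ultimately have "4 \<le> length p"
    by linarith
  then have "4 \<le> length q" if "H.awalk x q y" for q
    using H.unit_distance_le_length[OF that] mu by auto
  then obtain l :: "'a \<Rightarrow> nat" where l: "\<forall>v. l v \<le> 4"
      "\<forall>(a, b) \<in> parcs (complement G). l b \<le> l a + 1"
      "{..4} \<subseteq> l ` pverts G"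
    using H.distance_layers[OF scH, of x y 4] xy by auto
  show ?thesis
  \<comment> \<open>Complement arcs climb at most one layer, so a pair of vertices at least two
    layers apart is not adjacent in the complement and must be adjacent in \<open>G\<close>.\<close>
  proof (rule layered_four_rainbow_coloring)
    fix u v assume uv: "u \<in> pverts G" "v \<in> pverts G" "l u + 2 \<le> l v"
    then show "(u, v) \<in> parcs G"
      using l(2) arc_or_complement_arc[of u v] by force
  next
    show "{0, 1, 3, 4} \<subseteq> l ` pverts G"
      using l(3) by force
  qed (use l in auto)
qed

section \<open>Disconnected complement\<close>

lemma four_rainbow_coloring_complete:
  assumes "\<And>u v. u \<in> pverts G \<Longrightarrow> v \<in> pverts G \<Longrightarrow> u \<noteq> v \<Longrightarrow> (u, v) \<in> parcs G"
  shows "\<exists>c. edge_coloring G 4 c \<and> rainbow_connected G c"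
proof -
  have "rainbow_joined G (\<lambda>_. 1) u v" if "u \<in> pverts G" "v \<in> pverts G" for u v
    using assms that rainbow_joined_refl rainbow_joined_arc by metis
  then have "rainbow_connected G (\<lambda>_. 1)"
    by (simp add: rainbow_connected_def rainbow_joined_def)
  then show ?thesis
    by (intro exI[of _ "\<lambda>_. 1"]) (auto simp: edge_coloring_def)
qed

lemma four_rainbow_coloring_join:
  assumes "pverts G = S \<union> T" "S \<inter> T = {}"
    and ab: "a \<in> S" "a' \<in> S" "a \<noteq> a'" "b \<in> T" "b' \<in> T" "b \<noteq> b'"
    and "S \<times> T \<subseteq> parcs G"
  shows "\<exists>c. edge_coloring G 4 c \<and> rainbow_connected G c"
proof -
  define l :: "'a \<Rightarrow> nat" where
    \<comment> \<open>Skipping the value 2 makes the layers of two vertices differ by at least two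
      exactly when the vertices lie on opposite sides.\<close>
    "l v = (if v = a then 0 else if v \<in> S then 1 else if v = b then 3 else 4)" for v
  have "b \<notin> S" "b' \<notin> S"
    using assms by auto
  then have lv: "l a = 0" "l a' = 1" "l b = 3" "l b' = 4"
    using ab by (auto simp: l_def)
  show ?thesis
  proof (rule layered_four_rainbow_coloring)
    show "l v \<le> 4" for v
      by (simp add: l_def)
    show "(u, v) \<in> parcs G" if "u \<in> pverts G" "v \<in> pverts G" "l u + 2 \<le> l v" for u v
      using that assms by (auto simp: l_def split: if_splits)
    show "{0, 1, 3, 4} \<subseteq> l ` pverts G"
      using lv ab assms(1) by (auto simp: image_iff) (metis One_nat_def UnCI)+
  qed
qed

text \<open>Unless the complement is arcless, it has a component \<open>S\<close> containing an arc,
  so \<open>S\<close> has two vertices. No complement arc leaves \<open>S\<close>, hence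
  \<open>G\<close> joins \<open>S\<close> completely to the rest \<open>T\<close>; the hypothesis on
  components keeps \<open>T\<close> from being a single vertex.\<close>

lemma four_rainbow_coloring_disconnected_complement:
  assumes disconn: "\<not> connected (with_proj (complement G))"
    and comps: "\<not> (card (components (complement G)) = 2 \<and>
               (\<exists>C \<in> components (complement G). card (verts C) = 1))"
  shows "\<exists>c. edge_coloring G 4 c \<and> rainbow_connected G c"
proof (cases "parcs (complement G) = {}")
  case True
  then show ?thesis
    using arc_or_complement_arc by (intro four_rainbow_coloring_complete) auto
next
  case False
  interpret H: pair_graph "complement G"
    by (rule pair_graph_complement)
  let ?H = "with_proj (complement G)"
  obtain a a' where aa': "(a, a') \<in> parcs (complement G)"
    using False by auto
  then have a: "a \<in> pverts G" "a' \<in> pverts G" "a \<noteq> a'"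
    using H.in_arcsD1 H.in_arcsD2 H.no_loops' by auto
  define S where "S = {v. a \<rightarrow>\<^sup>*\<^bsub>?H\<^esub> v}"
  define T where "T = pverts G - S"
  have S_sub: "S \<subseteq> pverts G"
    unfolding S_def using H.reachable_in_verts(2) by fastforce
  have aS: "a \<in> S" "a' \<in> S"
    unfolding S_def using aa' a H.reachable_refl H.reachable_adjI by simp_all
  have sym: "v \<rightarrow>\<^sup>*\<^bsub>?H\<^esub> u" if "u \<rightarrow>\<^sup>*\<^bsub>?H\<^esub> v" for u v
    using that H.sym_arcs symmetric_reachable by metis
  have S_reach: "u \<rightarrow>\<^sup>*\<^bsub>?H\<^esub> v" if "u \<in> S" "v \<in> S" for u v
    using that sym[of a u] H.reachable_trans[of u a v] by (simp add: S_def)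
  have S_closed: "v \<in> S" if "u \<in> S" "u \<rightarrow>\<^sup>*\<^bsub>?H\<^esub> v" for u v
    using that H.reachable_trans[of a u v] by (simp add: S_def)
  have cross: "S \<times> T \<subseteq> parcs G"
  proof clarify
    fix u v assume uv: "u \<in> S" "v \<in> T"
    then have "(u, v) \<notin> parcs (complement G)"
      using S_closed[of u v] H.reachable_adjI[of u v] by (simp add: T_def) blast
    then show "(u, v) \<in> parcs G"
      using uv S_sub arc_or_complement_arc[of u v] by (auto simp: T_def)
  qed
  have "T \<noteq> {}"
  proof
    assume "T = {}"
    then have "strongly_connected ?H"
      using S_reach a by (intro strongly_connectedI) (auto simp: T_def)
    then show False
      using disconn H.strongly_connected_imp_connected by blast
  qed
  then obtain b where b: "b \<in> T"
    by blast
  \<comment> \<open>Otherwise \<open>S\<close> and \<open>{b}\<close> would be the only components,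
    one of them trivial, which \<open>comps\<close> forbids.\<close>
  have "T \<noteq> {b}"
  proof
    assume T: "T = {b}"
    have b_reach: "v = b" if "b \<rightarrow>\<^sup>*\<^bsub>?H\<^esub> v" for v
    proof -
      have "v \<in> pverts G"
        using H.reachable_in_verts(2)[OF that] by simp
      moreover have "v \<notin> S"
        using S_closed[OF _ sym[OF that]] b by (auto simp: T_def)
      ultimately show ?thesis
        using T by (simp add: T_def set_eq_iff) blast
    qed
    have "S \<in> H.sccs_verts"
      unfolding H.in_sccs_verts_conv_reachable using aS(1) S_reach S_closed
      by (metis empty_iff)
    moreover have "b \<rightarrow>\<^sup>*\<^bsub>?H\<^esub> b"
      using b by (intro H.reachable_refl) (simp add: T_def)
    then have "T \<in> H.sccs_verts"
      unfolding H.in_sccs_verts_conv_reachable T using b_reach by (metis insert_not_empty singletonD singletonI)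
    \<comment> \<open>A component is nonempty, so it meets \<open>S\<close> or \<open>T\<close>;
      distinct components are disjoint, so it coincides with the one it meets.\<close>
    moreover have "X = S \<or> X = T" if "X \<in> H.sccs_verts" for X
    proof -
      obtain v where "v \<in> X" "v \<rightarrow>\<^sup>*\<^bsub>?H\<^esub> v"
        using \<open>X \<in> H.sccs_verts\<close> H.in_sccs_verts_conv_reachable by (metis ex_in_conv)
      then have "v \<in> S \<or> v \<in> T"
        using H.reachable_in_verts(1)[of v v] by (simp add: T_def)
      then show ?thesis
        using H.sccs_verts_disjoint[OF that] \<open>S \<in> _\<close> \<open>T \<in> _\<close> \<open>v \<in> X\<close> by blast
    qed
    ultimately have sv: "H.sccs_verts = {S, T}"
      by blast
    moreover have "S \<noteq> T"
      using aS by (auto simp: T_def)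
    ultimately have "card H.sccs = 2"
      using H.card_sccs_verts by simp
    moreover have "T \<in> verts ` H.sccs"
      using sv by (simp flip: H.sccs_verts_conv)
    then obtain C where "C \<in> H.sccs" "card (verts C) = 1"
      using T by (metis imageE is_singletonI is_singleton_altdef)
    ultimately show False
      using comps by blast
  qed
  then obtain b' where "b' \<in> T" "b \<noteq> b'"
    using b by blast
  then show ?thesis
    using four_rainbow_coloring_join[of S T a a' b b'] S_sub aS a(3) b cross by (auto simp: T_def)
qed

end

lemma four_rainbow_coloring:
  assumes "pair_graph G" "nontrivial_graph G" "connected (with_proj G)"
    and "\<not> (connected (with_proj (complement G)) \<and> diam (complement G) \<in> {2, 3})"
    and "\<not> (card (components (complement G)) = 2 \<and>
               (\<exists>C \<in> components (complement G). card (verts C) = 1))"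
  shows "\<exists>c. edge_coloring G 4 c \<and> rainbow_connected G c"
  using assms pair_graph.four_rainbow_coloring_connected_complement
    pair_graph.four_rainbow_coloring_disconnected_complement by blast

section \<open>Sharpness\<close>

text \<open>The sides are \<open>{0, 1}\<close> and \<open>{2..<12}\<close>. Ten vertices on the
  large side are one more than the nine ordered pairs of three colours.\<close>

definition K2_10 :: "nat pair_pre_digraph" where
  "K2_10 = \<lparr>pverts = {..<12}, parcs = {(u, v). u < 12 \<and> v < 12 \<and> (u < 2) \<noteq> (v < 2)}\<rparr>"

lemma pverts_K2_10: "v \<in> pverts K2_10 \<longleftrightarrow> v < 12"
  by (simp add: K2_10_def)

lemma parcs_K2_10: "(u, v) \<in> parcs K2_10 \<longleftrightarrow> u < 12 \<and> v < 12 \<and> (u < 2) \<noteq> (v < 2)"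
  by (simp add: K2_10_def)

lemma pair_graph_K2_10: "pair_graph K2_10"
proof -
  have "parcs K2_10 \<subseteq> {..<12} \<times> {..<12}"
    by (auto simp: K2_10_def)
  then have "finite (parcs K2_10)"
    by (rule finite_subset) simp
  then show ?thesis
    by unfold_locales (auto simp: K2_10_def symmetric_def intro!: symI)
qed

interpretation K: pair_graph K2_10
  by (rule pair_graph_K2_10)

interpretation KC: pair_graph "complement K2_10"
  by (rule K.pair_graph_complement)

lemma connected_K2_10: "connected (with_proj K2_10)"
proof -
  have "strongly_connected (with_proj K2_10)"
  proof (rule strongly_connectedI)
    show "verts (with_proj K2_10) \<noteq> {}"
      by (simp add: K2_10_def lessThan_empty_iff bot_nat_def)
    fix u v assume uv: "u \<in> verts (with_proj K2_10)" "v \<in> verts (with_proj K2_10)"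
    then have V: "u < 12" "v < 12"
      by (auto simp: K2_10_def)
    show "u \<rightarrow>\<^sup>*\<^bsub>with_proj K2_10\<^esub> v"
    proof (cases "(u < 2) = (v < 2)")
      case True
      define w :: nat where "w = (if u < 2 then 2 else 0)"
      have "(u, w) \<in> parcs K2_10" "(w, v) \<in> parcs K2_10"
        using True V by (auto simp: K2_10_def w_def)
      then show ?thesis
        by (meson K.adj_reachable_trans K.reachable_adjI)
    next
      case False
      then have "(u, v) \<in> parcs K2_10"
        using V by (auto simp: K2_10_def)
      then show ?thesis by auto
    qed
  qed
  then show ?thesis
    by (rule K.strongly_connected_imp_connected)
qed

lemma not_connected_complement_K2_10: "\<not> connected (with_proj (complement K2_10))"
proof
  assume "connected (with_proj (complement K2_10))"
  then have "strongly_connected (with_proj (complement K2_10))"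
    using KC.sym_arcs by (intro KC.symmetric_connected_imp_strongly_connected)
  moreover have "0 \<in> pverts K2_10" "2 \<in> pverts K2_10"
    by (auto simp: K2_10_def)
  ultimately have "0 \<rightarrow>\<^sup>*\<^bsub>with_proj (complement K2_10)\<^esub> (2::nat)"
    by (auto simp: strongly_connected_def)
  \<comment> \<open>Complement arcs stay within a side, whereas 0 and 2 lie on different
    sides.\<close>
  moreover have side: "u < 2 \<longleftrightarrow> v < 2" if "u \<rightarrow>\<^sup>*\<^bsub>with_proj (complement K2_10)\<^esub> v" for u v :: nat
    using that by (induction rule: KC.reachable_induct) (auto simp: complement_def K2_10_def)
  ultimately show False
    using side[of 0 2] by simp
qed

lemma component_complement_K2_10_nontrivial:
  assumes "C \<in> components (complement K2_10)"
  shows "card (verts C) \<noteq> 1"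
proof
  assume "card (verts C) = 1"
  then obtain v where v: "verts C = {v}"
    using card_1_singletonE by blast
  have scc: "{v} \<in> KC.sccs_verts"
    unfolding KC.sccs_verts_conv using assms v by (metis imageI)
  then have "v \<rightarrow>\<^sup>*\<^bsub>with_proj (complement K2_10)\<^esub> v"
    by (simp add: KC.in_sccs_verts_conv_reachable)
  then have "v \<in> pverts K2_10"
    using KC.reachable_in_verts(1)[of v v] by simp
  then have "v < 12"
    by (simp add: K2_10_def)
  \<comment> \<open>A second vertex on the side of \<open>v\<close>; the sides are cliques of the
    complement, so it shares the component of \<open>v\<close>.\<close>
  define w where "w = (if v = 0 then 1 else if v = 1 then 0 else if v = 2 then 3 else 2 :: nat)"
  have "w \<noteq> v" "(v, w) \<in> parcs (complement K2_10)"
    using \<open>v < 12\<close> by (auto simp: complement_def K2_10_def w_def)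
  then have "v \<rightarrow>\<^sup>*\<^bsub>with_proj (complement K2_10)\<^esub> w" "w \<rightarrow>\<^sup>*\<^bsub>with_proj (complement K2_10)\<^esub> v"
    using KC.arcs_symmetric by auto
  with scc \<open>w \<noteq> v\<close> show False
    by (simp add: KC.in_sccs_verts_conv_reachable)
qed

lemma no_three_rainbow_coloring_K2_10:
  assumes "k \<le> 3" and col: "edge_coloring K2_10 k c"
  shows "\<not> rainbow_connected K2_10 c"
proof
  assume rainbow_conn: "rainbow_connected K2_10 c"
  have c_arc: "c (uedge e) \<in> {1..3}" if "e \<in> parcs K2_10" for e
    using col that \<open>k \<le> 3\<close> by (force simp: edge_coloring_def uedges_def Pi_iff)
  \<comment> \<open>The colours that \<open>w\<close> sees towards the two vertices of the small
    side; by the pigeonhole principle two of the ten vertices agree.\<close>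
  define g where "g w = (c {0, w}, c {1, w})" for w
  have "g ` {2..<12} \<subseteq> {1..3} \<times> {1..3}"
  proof (rule image_subsetI)
    fix w :: nat assume "w \<in> {2..<12}"
    then have "(0, w) \<in> parcs K2_10" "(1, w) \<in> parcs K2_10"
      by (auto simp: pverts_K2_10 parcs_K2_10)
    from this[THEN c_arc] show "g w \<in> {1..3} \<times> {1..3}"
      by (simp add: g_def uedge_def)
  qed
  from card_mono[OF _ this] have "card (g ` {2..<12}) \<le> 9"
    by simp
  then have "\<not> inj_on g {2..<12}"
    using card_image[of g "{2..<12}"] by auto
  then obtain w w' where w: "w \<in> {2..<12}" "w' \<in> {2..<12}" "w \<noteq> w'" "g w = g w'"
    by (auto simp: inj_on_def)
  have "w \<in> pverts K2_10" "w' \<in> pverts K2_10"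
    using w by (auto simp: pverts_K2_10 parcs_K2_10)
  then obtain p where p: "K.apath w p w'" and rb: "rainbow c p"
    using rainbow_conn unfolding rainbow_connected_def by blast
  have walk: "K.awalk w p w'"
    using p by (rule K.awalkI_apath)
  then have "set (map (\<lambda>e. c (uedge e)) p) \<subseteq> {1..3}"
    using c_arc by (auto simp: K.awalk_def simp del: atLeastAtMost_iff)
  \<comment> \<open>A rainbow path has no more edges than there are colours.\<close>
  from card_mono[OF _ this] rb have "length p \<le> 3"
    by (simp only: rainbow_def distinct_card length_map) simp
  then consider "p = []" | e1 where "p = [e1]" | e1 e2 where "p = [e1, e2]"
    | e1 e2 e3 where "p = [e1, e2, e3]"
    by (auto simp: le_Suc_eq length_Suc_conv numeral_3_eq_3)
  then show False
  proof cases
    \<comment> \<open>Bipartiteness and \<open>w \<noteq> w'\<close> leave only length 2. The middle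
      vertex is 0 or 1, and both edges have equal colours because \<open>g w = g w'\<close>.\<close>
    case 3
    obtain m where "e1 = (w, m)" "e2 = (m, w')" "m < 2"
      using walk w 3 by (cases e1; cases e2) (auto simp: K.awalk_simps parcs_K2_10)
    then have "c {w, m} \<noteq> c {m, w'}" and "m = 0 \<or> m = 1"
      using rb 3 by (auto simp: rainbow_def uedge_def)
    then show False
      using w(4) by (auto simp: g_def insert_commute)
  qed (use walk w in \<open>auto simp: K.awalk_simps parcs_K2_10\<close>)
qed

theorem theorem1p1:
  shows "(\<forall>G :: 'a pair_pre_digraph.
            pair_graph G \<longrightarrow> nontrivial_graph G \<longrightarrow> connected (with_proj G) \<longrightarrow>
            \<not> (connected (with_proj (complement G)) \<and> diam (complement G) \<in> {2, 3}) \<longrightarrow>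
            \<not> (card (components (complement G)) = 2 \<and>
               (\<exists>C \<in> components (complement G). card (verts C) = 1)) \<longrightarrow>
            rc G \<le> 4)
       \<and> (\<exists>G :: nat pair_pre_digraph.
            pair_graph G \<and> nontrivial_graph G \<and> connected (with_proj G) \<and>
            \<not> (connected (with_proj (complement G)) \<and> diam (complement G) \<in> {2, 3}) \<and>
            \<not> (card (components (complement G)) = 2 \<and>
               (\<exists>C \<in> components (complement G). card (verts C) = 1)) \<and>
            rc G = 4)"
proof (intro conjI allI impI)
  fix G :: "'a pair_pre_digraph"
  assume "pair_graph G" "nontrivial_graph G" "connected (with_proj G)"
    "\<not> (connected (with_proj (complement G)) \<and> diam (complement G) \<in> {2, 3})"
    "\<not> (card (components (complement G)) = 2 \<and>
         (\<exists>C \<in> components (complement G). card (verts C) = 1))"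
  then show "rc G \<le> 4"
    unfolding rc_def by (intro Least_le four_rainbow_coloring)
next
  let ?G = K2_10
  have nontrivial: "nontrivial_graph ?G"
    by (simp add: nontrivial_graph_def K2_10_def)
  have ex4: "\<exists>c. edge_coloring ?G 4 c \<and> rainbow_connected ?G c"
    using pair_graph_K2_10 nontrivial connected_K2_10 not_connected_complement_K2_10
      component_complement_K2_10_nontrivial by (intro four_rainbow_coloring) auto
  \<comment> \<open>The 4-colouring shows that some \<open>k\<close> is admissible, so the least one
    is attained and the lower bound applies with \<open>k\<close> equal to
    \<open>rc ?G\<close>.\<close>
  then have "\<exists>c. edge_coloring ?G (rc ?G) c \<and> rainbow_connected ?G c"
    unfolding rc_def by (rule LeastI)
  then have "\<not> rc ?G \<le> 3"
    using no_three_rainbow_coloring_K2_10 by blast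
  moreover have "rc ?G \<le> 4"
    unfolding rc_def using ex4 by (rule Least_le)
  ultimately have "rc ?G = 4"
    by linarith
  then show "\<exists>G :: nat pair_pre_digraph.
            pair_graph G \<and> nontrivial_graph G \<and> connected (with_proj G) \<and>
            \<not> (connected (with_proj (complement G)) \<and> diam (complement G) \<in> {2, 3}) \<and>
            \<not> (card (components (complement G)) = 2 \<and>
               (\<exists>C \<in> components (complement G). card (verts C) = 1)) \<and>
            rc G = 4"
    using pair_graph_K2_10 nontrivial connected_K2_10 not_connected_complement_K2_10
      component_complement_K2_10_nontrivial by blast
qed

end
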